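(* Let $P$ be a unary and $R$ a binary relation symbol, and let $$\Sigma(P,R):=\forall x_1\Bigl[\bigl(P(x_1)\rightarrow\forall x_2(R(x_1,x_2)\leftrightarrow P(x_2))\bigr)\wedge\bigl(\neg P(x_1)\rightarrow\forall x_2\neg R(x_1,x_2)\bigr)\Bigr].$$ Over all structures, $R$ has no explicit fluted definition relative to the singleton theory $\{\Sigma(P,R)\}$; that is, there is no formula $\delta\in\mathsf{FL}[2](\{P\})$ such that for every $\{P\}$-structure $\mathfrak A$ and every $R^{\ast}\subseteq A^2$ with $(\mathfrak A,R^{\ast})\models\Sigma(P,R)$, and for all $(a_1,a_2)\in A^2$, $$R^{\ast}(a_1,a_2)\iff\mathfrak A\models\delta[a_1,a_2].$$
   Context: All structures have non-empty domains; there is no equality in the language. Fluted fragment. Fix variables $x_1,x_2,\ldots$. For a finite signature $\tau$ of relation symbols of positive arity, the levels $\mathsf{FL}[m](\tau)$, $m\ge 0$, are defined by simultaneous induction: $\top,\bot\in\mathsf{FL}[m](\tau)$; if $Q\in\tau$ has arity $r\le m$, then the suffix atom $Q(x_{m-r+1},\ldots,x_m)$ is in $\mathsf{FL}[m](\tau)$; $\mathsf{FL}[m](\tau)$ is closed under $\neg,\wedge,\vee$; if $\varphi\in\mathsf{FL}[m+1](\tau)$, then $\exists x_{m+1}\varphi,\forall x_{m+1}\varphi\in\mathsf{FL}[m](\tau)$. For $\varphi\in\mathsf{FL}[m](\tau)$ and $\bar a\in A^m$, $\mathfrak A\models\varphi[\bar a]$ means that $\varphi$ is true in $\mathfrak A$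 under the assignment $x_i\mapsto a_i$ ($1\le i\le m$). *)

theory Defs
  imports Main
begin

text \<open>
  First-order formulas without equality over relation symbols of type \<open>'s\<close>.  The variable
  \<open>x\<^sub>i\<close> is represented by the natural number \<open>i\<close>.
\<close>

datatype 's fm =
    Top
  | Bot
  | Atom 's "nat list"
  | Neg "'s fm"
  | Conj "'s fm" "'s fm"
  | Disj "'s fm" "'s fm"
  | Exists nat "'s fm"
  | Forall nat "'s fm"

definition Imp :: "'s fm \<Rightarrow> 's fm \<Rightarrow> 's fm" where
  "Imp \<phi> \<psi> = Disj (Neg \<phi>) \<psi>"

definition Iff :: "'s fm \<Rightarrow> 's fm \<Rightarrow> 's fm" where
  "Iff \<phi> \<psi> = Conj (Imp \<phi> \<psi>) (Imp \<psi> \<phi>)"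

text \<open>
  \<open>fluted ar \<tau> m\<close> is membership in the level \<open>FL[m](\<tau>)\<close>, where \<open>ar\<close> gives the arities of the
  symbols.  The variable list in \<open>fluted_atom\<close> is \<open>x\<^bsub>m-r+1\<^esub>, \<dots>, x\<^sub>m\<close> with \<open>r = ar Q\<close>.
\<close>

inductive fluted :: "('s \<Rightarrow> nat) \<Rightarrow> 's set \<Rightarrow> nat \<Rightarrow> 's fm \<Rightarrow> bool"
  for ar :: "'s \<Rightarrow> nat" and \<tau> :: "'s set" where
  fluted_top: "fluted ar \<tau> m Top"
| fluted_bot: "fluted ar \<tau> m Bot"
| fluted_atom: "Q \<in> \<tau> \<Longrightarrow> ar Q \<le> m \<Longrightarrow> fluted ar \<tau> m (Atom Q [m - ar Q + 1..<m + 1])"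
| fluted_neg: "fluted ar \<tau> m \<phi> \<Longrightarrow> fluted ar \<tau> m (Neg \<phi>)"
| fluted_conj: "fluted ar \<tau> m \<phi> \<Longrightarrow> fluted ar \<tau> m \<psi> \<Longrightarrow> fluted ar \<tau> m (Conj \<phi> \<psi>)"
| fluted_disj: "fluted ar \<tau> m \<phi> \<Longrightarrow> fluted ar \<tau> m \<psi> \<Longrightarrow> fluted ar \<tau> m (Disj \<phi> \<psi>)"
| fluted_exists: "fluted ar \<tau> (m + 1) \<phi> \<Longrightarrow> fluted ar \<tau> m (Exists (m + 1) \<phi>)"
| fluted_forall: "fluted ar \<tau> (m + 1) \<phi> \<Longrightarrow> fluted ar \<tau> m (Forall (m + 1) \<phi>)"

definition FL :: "('s \<Rightarrow> nat) \<Rightarrow> nat \<Rightarrow> 's set \<Rightarrow> 's fm set" where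
  "FL ar m \<tau> = {\<phi>. fluted ar \<tau> m \<phi>}"

text \<open>
  The domain is an arbitrary subset of the ambient type \<open>'a\<close>.  If \<open>'a\<close> is infinite, every countable
  structure occurs up to isomorphism, so by the downward Loewenheim-Skolem theorem validity over all
  structures with domain in \<open>'a\<close> is validity over all structures whatsoever.
\<close>

record ('s, 'a) struct =
  domain :: "'a set"
  interp :: "'s \<Rightarrow> 'a list set"

text \<open>
  Symbols outside the signature are interpreted by the empty relation, so that a \<open>\<tau>\<close>-structure
  carries no information beyond its domain and the interpretation of \<open>\<tau>\<close>.
\<close>

definition is_struct :: "('s \<Rightarrow> nat) \<Rightarrow> 's set \<Rightarrow> ('s, 'a) struct \<Rightarrow> bool" where
  "is_struct ar \<tau> \<AA> \<longleftrightarrow>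
     domain \<AA> \<noteq> {} \<and>
     (\<forall>Q\<in>\<tau>. interp \<AA> Q \<subseteq> {as. length as = ar Q \<and> set as \<subseteq> domain \<AA>}) \<and>
     (\<forall>Q. Q \<notin> \<tau> \<longrightarrow> interp \<AA> Q = {})"

definition expand :: "('s, 'a) struct \<Rightarrow> 's \<Rightarrow> ('a \<times> 'a) set \<Rightarrow> ('s, 'a) struct" where
  "expand \<AA> R S = \<AA>\<lparr>interp := (interp \<AA>)(R := {[a, b] | a b. (a, b) \<in> S})\<rparr>"

primrec sat :: "('s, 'a) struct \<Rightarrow> (nat \<Rightarrow> 'a) \<Rightarrow> 's fm \<Rightarrow> bool" where
  "sat \<AA> e Top \<longleftrightarrow> True"
| "sat \<AA> e Bot \<longleftrightarrow> False"
| "sat \<AA> e (Atom Q xs) \<longleftrightarrow> map e xs \<in> interp \<AA> Q"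
| "sat \<AA> e (Neg \<phi>) \<longleftrightarrow> \<not> sat \<AA> e \<phi>"
| "sat \<AA> e (Conj \<phi> \<psi>) \<longleftrightarrow> sat \<AA> e \<phi> \<and> sat \<AA> e \<psi>"
| "sat \<AA> e (Disj \<phi> \<psi>) \<longleftrightarrow> sat \<AA> e \<phi> \<or> sat \<AA> e \<psi>"
| "sat \<AA> e (Exists i \<phi>) \<longleftrightarrow> (\<exists>a\<in>domain \<AA>. sat \<AA> (e(i := a)) \<phi>)"
| "sat \<AA> e (Forall i \<phi>) \<longleftrightarrow> (\<forall>a\<in>domain \<AA>. sat \<AA> (e(i := a)) \<phi>)"

text \<open>
  Truth of \<open>\<phi>\<close> at the tuple \<open>as\<close>, i.e. under \<open>x\<^sub>i \<mapsto> a\<^sub>i\<close> for \<open>1 \<le> i \<le> m\<close>.  It is used only for formulas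
  whose free variables are among \<open>x\<^sub>1, \<dots>, x\<^sub>m\<close>, where the values of the other variables are
  irrelevant (\<open>fluted_sat_cong\<close> below).
\<close>

definition sat_at :: "('s, 'a) struct \<Rightarrow> 's fm \<Rightarrow> 'a list \<Rightarrow> bool" where
  "sat_at \<AA> \<phi> as \<longleftrightarrow>
     sat \<AA> (\<lambda>i. if 1 \<le> i \<and> i \<le> length as then as ! (i - 1) else undefined) \<phi>"

definition models :: "('s, 'a) struct \<Rightarrow> 's fm set \<Rightarrow> bool" where
  "models \<AA> T \<longleftrightarrow> (\<forall>\<phi>\<in>T. sat_at \<AA> \<phi> [])"

definition Sigma_PR :: "'s \<Rightarrow> 's \<Rightarrow> 's fm" where
  "Sigma_PR P R =
     Forall 1 (Conj
       (Imp (Atom P [1]) (Forall 2 (Iff (Atom R [1, 2]) (Atom P [2]))))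
       (Imp (Neg (Atom P [1])) (Forall 2 (Neg (Atom R [1, 2])))))"

lemma fluted_sat_cong:
  assumes "fluted ar \<tau> m \<phi>" and "\<And>i. 1 \<le> i \<Longrightarrow> i \<le> m \<Longrightarrow> e i = e' i"
  shows "sat \<AA> e \<phi> \<longleftrightarrow> sat \<AA> e' \<phi>"
  using assms
proof (induction arbitrary: e e' rule: fluted.induct)
  case (fluted_atom Q m)
  then have "map e [m - ar Q + 1..<m + 1] = map e' [m - ar Q + 1..<m + 1]"
    by (intro map_cong) auto
  then show ?case by (simp only: sat.simps)
next
  case (fluted_neg m \<phi>)
  then show ?case by (metis sat.simps(4))
next
  case (fluted_conj m \<phi> \<psi>)
  then show ?case by (metis sat.simps(5))
next
  case (fluted_disj m \<phi> \<psi>)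
  then show ?case by (metis sat.simps(6))
next
  case (fluted_exists m \<phi>)
  have "sat \<AA> (e(m + 1 := a)) \<phi> \<longleftrightarrow> sat \<AA> (e'(m + 1 := a)) \<phi>" for a
    by (rule fluted_exists.IH) (use fluted_exists.prems in auto)
  then show ?case by (simp only: sat.simps)
next
  case (fluted_forall m \<phi>)
  have "sat \<AA> (e(m + 1 := a)) \<phi> \<longleftrightarrow> sat \<AA> (e'(m + 1 := a)) \<phi>" for a
    by (rule fluted_forall.IH) (use fluted_forall.prems in auto)
  then show ?case by (simp only: sat.simps)
qed simp_all

lemma models_Sigma_PR:
  assumes "P \<noteq> R"
  shows "models (expand \<AA> R S) {Sigma_PR P R} \<longleftrightarrow>
    (\<forall>a\<in>domain \<AA>.
       ([a] \<in> interp \<AA> P \<longrightarrow> (\<forall>b\<in>domain \<AA>. (a, b) \<in> S \<longleftrightarrow> [b] \<in> interp \<AA> P)) \<and>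
       ([a] \<notin> interp \<AA> P \<longrightarrow> (\<forall>b\<in>domain \<AA>. (a, b) \<notin> S)))"
  using assms
  by (auto simp: models_def sat_at_def Sigma_PR_def Imp_def Iff_def expand_def)

end

theory Submission
  imports Defs
begin

text \<open>
  The atoms of a fluted formula are suffix atoms, so over a purely unary signature the truth of
  \<open>\<delta> \<in> FL[2]\<close> depends on \<open>a\<^sub>2\<close> alone.  The relation forced by \<open>\<Sigma>(P, R)\<close> is \<open>P \<times> P\<close>, which depends on
  \<open>a\<^sub>1\<close> as soon as \<open>P\<close> is neither empty nor full.
\<close>

text \<open>With arities bounded by \<open>k\<close>, an atom at level \<open>m\<close> sees only
  the window of the last \<open>k\<close> variables. A quantifier moves the window up by one, and
  its new last variable gets the same value on both sides. The window is written
  \<open>m < i + k\<close> because subtraction on naturals truncates.\<close>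

lemma fluted_sat_cong_suffix:
  assumes "fluted ar \<tau> m \<phi>" and "\<And>Q. Q \<in> \<tau> \<Longrightarrow> ar Q \<le> k"
    and "\<And>i. m < i + k \<Longrightarrow> i \<le> m \<Longrightarrow> e i = e' i"
  shows "sat \<AA> e \<phi> \<longleftrightarrow> sat \<AA> e' \<phi>"
  using assms(1,3)
proof (induction arbitrary: e e' rule: fluted.induct)
  case (fluted_atom Q m)
  have "map e [m - ar Q + 1..<m + 1] = map e' [m - ar Q + 1..<m + 1]"
  proof (rule map_cong)
    fix i assume "i \<in> set [m - ar Q + 1..<m + 1]"
    then show "e i = e' i"
      using assms(2)[OF fluted_atom.hyps(1)] by (intro fluted_atom.prems) auto
  qed simp
  then show ?case by (simp only: sat.simps)
next
  case (fluted_neg m \<phi>)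
  then show ?case by (metis sat.simps(4))
next
  case (fluted_conj m \<phi> \<psi>)
  then show ?case by (metis sat.simps(5))
next
  case (fluted_disj m \<phi> \<psi>)
  then show ?case by (metis sat.simps(6))
next
  case (fluted_exists m \<phi>)
  \<comment> \<open>An index of the window at level \<open>m + 1\<close> is either
    \<open>m + 1\<close>, where both updates give \<open>a\<close>, or already in the window at
    level \<open>m\<close>.\<close>
  have "sat \<AA> (e(m + 1 := a)) \<phi> \<longleftrightarrow> sat \<AA> (e'(m + 1 := a)) \<phi>" for a
    by (rule fluted_exists.IH) (use fluted_exists.prems in auto)
  then show ?case by (simp only: sat.simps)
next
  case (fluted_forall m \<phi>)
  have "sat \<AA> (e(m + 1 := a)) \<phi> \<longleftrightarrow> sat \<AA> (e'(m + 1 := a)) \<phi>" for a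
    by (rule fluted_forall.IH) (use fluted_forall.prems in auto)
  then show ?case by (simp only: sat.simps)
qed simp_all

theorem theorem5p5:
  fixes ar :: "'s \<Rightarrow> nat" and P R :: 's
  assumes "ar P = 1" and "ar R = 2"
    and "infinite (UNIV :: 'a set)"
  shows "\<not> (\<exists>\<delta>\<in>FL ar 2 {P}.
           \<forall>(\<AA> :: ('s, 'a) struct) S.
             is_struct ar {P} \<AA> \<longrightarrow> S \<subseteq> domain \<AA> \<times> domain \<AA> \<longrightarrow>
             models (expand \<AA> R S) {Sigma_PR P R} \<longrightarrow>
             (\<forall>a\<^sub>1\<in>domain \<AA>. \<forall>a\<^sub>2\<in>domain \<AA>.
                (a\<^sub>1, a\<^sub>2) \<in> S \<longleftrightarrow> sat_at \<AA> \<delta> [a\<^sub>1, a\<^sub>2]))"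
proof (rule notI, elim bexE)
  fix \<delta>
  assume "\<delta> \<in> FL ar 2 {P}"
    and def: "\<forall>(\<AA> :: ('s, 'a) struct) S.
             is_struct ar {P} \<AA> \<longrightarrow> S \<subseteq> domain \<AA> \<times> domain \<AA> \<longrightarrow>
             models (expand \<AA> R S) {Sigma_PR P R} \<longrightarrow>
             (\<forall>a\<^sub>1\<in>domain \<AA>. \<forall>a\<^sub>2\<in>domain \<AA>.
                (a\<^sub>1, a\<^sub>2) \<in> S \<longleftrightarrow> sat_at \<AA> \<delta> [a\<^sub>1, a\<^sub>2])"
  then have fluted: "fluted ar {P} 2 \<delta>" by (simp add: FL_def)
  have "P \<noteq> R" using assms(1,2) by auto
  obtain a :: 'a where True by simp
  obtain b where "b \<noteq> a"
    using ex_new_if_finite[OF assms(3), of "{a}"] by auto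
  \<comment> \<open>Two points suffice to make \<open>P\<close> neither empty nor full; then
    \<open>P \<times> P\<close> is \<open>{(a, a)}\<close>.\<close>
  define \<AA> :: "('s, 'a) struct"
    where "\<AA> = \<lparr>domain = {a, b}, interp = (\<lambda>_. {})(P := {[a]})\<rparr>"
  have "is_struct ar {P} \<AA>"
    using assms(1) by (auto simp: is_struct_def \<AA>_def)
  moreover have "models (expand \<AA> R {(a, a)}) {Sigma_PR P R}"
    using \<open>b \<noteq> a\<close> by (auto simp: models_Sigma_PR[OF \<open>P \<noteq> R\<close>] \<AA>_def)
  moreover have "{(a, a)} \<subseteq> domain \<AA> \<times> domain \<AA>"
    by (simp add: \<AA>_def)
  ultimately have
    "\<forall>a\<^sub>1\<in>domain \<AA>. \<forall>a\<^sub>2\<in>domain \<AA>. (a\<^sub>1, a\<^sub>2) \<in> {(a, a)} \<longleftrightarrow> sat_at \<AA> \<delta> [a\<^sub>1, a\<^sub>2]"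
    using def by blast
  \<comment> \<open>These two pairs share the second coordinate but only the first lies in
    \<open>P \<times> P\<close>.\<close>
  then have "sat_at \<AA> \<delta> [a, a]" and "\<not> sat_at \<AA> \<delta> [b, a]"
    using \<open>b \<noteq> a\<close> by (auto simp: \<AA>_def)
  moreover have "sat_at \<AA> \<delta> [a, a] \<longleftrightarrow> sat_at \<AA> \<delta> [b, a]"
    unfolding sat_at_def
  \<comment> \<open>Since \<open>P\<close> is unary, \<open>k = 1\<close> works, and the window at
    level 2 is the single index 2, where both assignments give \<open>a\<close>.\<close>
  proof (rule fluted_sat_cong_suffix[OF fluted, where k = 1])
    fix i :: nat assume "2 < i + 1" and "i \<le> 2"
    then have "i = 2" by simp
    then show "(if 1 \<le> i \<and> i \<le> length [a, a] then [a, a] ! (i - 1) else undefined) =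
        (if 1 \<le> i \<and> i \<le> length [b, a] then [b, a] ! (i - 1) else undefined)"
      by simp
  qed (use assms(1) in simp)
  ultimately show False by blast
qed

end
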